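(* Let $\alpha,\beta\in(0,1]$, $\lambda,\mu>0$, and let $(T_k)_{k\ge1}$ be the sequence of inter-arrival times of the renewal Mittag-Leffler queue ${}_3Q$ with orders $\alpha,\beta$ and rates $\lambda,\mu$. Then, for every $k\ge1$ and $t>0$, $$\mathbb{P}(T_k>t)=\sum_{j=0}^{+\infty}\bigl(1-F^{\ast(j+1)}(t)\bigr)(1-p)^jp.$$
   Context: $E_\alpha(x)=\sum_{k\ge0} x^k/\Gamma(\alpha k+1)$ is the Mittag-Leffler function; $X\sim\mathsf{ML}_\alpha(\lambda)$ means $X\ge0$ and $\mathbb{P}(X>t)=E_\alpha(-\lambda t^\alpha)$ for $t\ge 0$. Set $F(t)=1-E_\alpha(-\lambda t^\alpha)E_\beta(-\mu t^\beta)$, $F^{\ast 1}=F$ and $F^{\ast k}(t)=\int_0^t F^{\ast(k-1)}(t-s)\,dF(s)$. Let $p=\mathbb{P}(X^{(1)}<X^{(2)})$ with $X^{(1)}\sim \mathsf{ML}_\alpha(\lambda)$ and $X^{(2)}\sim\mathsf{ML}_\beta(\mu)$ independent. The renewal Mittag-Leffler queue: let $(\chi_k)_{k\ge1}$ be i.i.d. with $\mathbb{P}(\chi_k=1)=p$, $\mathbb{P}(\chi_k=-1)=1-p$, and $r_0=0$, $r_k=\sum_{j=1}^k\chi_j$. Let $(Y_k)_{k\ge1}$ be i.i.d. with distribution function $F$, independent of $(\chi_k)$, $\widetilde N(t)=\max\{k\ge0:\sum_{j=1}^kY_j\le t\}$ and $R(t)=r_{\widetilde N(t)}$. The queue length process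 is ${}_3Q=\Phi(R)$, where $\Phi(f)(t)=f(t)+\sup_{0\le s\le t}\max\{-f(s),0\}$ is the Skorokhod reflection map. Arrival times: $A_0=0$ and $A_n=\min\{t>A_{n-1}:{}_3Q(t)={}_3Q(t-)+1\}$ for $n\ge1$. Inter-arrival times: $T_n=A_n-A_{n-1}$. *)

theory Defs
  imports "HOL-Probability.Probability"
begin

definition mittag_leffler :: "real \<Rightarrow> real \<Rightarrow> real" where
  "mittag_leffler \<alpha> x = (\<Sum>k. x ^ k / Gamma (\<alpha> * real k + 1))"

definition mittag_leffler_distributed :: "'a measure \<Rightarrow> ('a \<Rightarrow> real) \<Rightarrow> real \<Rightarrow> real \<Rightarrow> bool" where
  "mittag_leffler_distributed M X \<alpha> lam \<longleftrightarrow>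
     X \<in> borel_measurable M \<and> (AE \<omega> in M. X \<omega> \<ge> 0) \<and>
     (\<forall>t\<ge>0. measure M {\<omega> \<in> space M. X \<omega> > t} = mittag_leffler \<alpha> (- lam * t powr \<alpha>))"

text \<open>The distribution function \<open>F\<close> of the minimum of two independent Mittag-Leffler variables,
  extended by \<open>0\<close> to the negative half-line.\<close>
definition min_mittag_leffler_cdf :: "real \<Rightarrow> real \<Rightarrow> real \<Rightarrow> real \<Rightarrow> real \<Rightarrow> real" where
  "min_mittag_leffler_cdf \<alpha> lam \<beta> \<mu> t =
     (if t < 0 then 0
      else 1 - mittag_leffler \<alpha> (- lam * t powr \<alpha>) * mittag_leffler \<beta> (- \<mu> * t powr \<beta>))"

text \<open>Stieltjes convolution powers; \<open>dF\<close> is the Lebesgue-Stieltjes measure of \<open>F\<close>. The family is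
  meant to start at \<open>F\<^sup>*\<^sup>1 = F\<close>; index \<open>0\<close> carries the usual neutral element.\<close>
fun conv_power :: "(real \<Rightarrow> real) \<Rightarrow> nat \<Rightarrow> real \<Rightarrow> real" where
  "conv_power F 0 = indicator {0..}"
| "conv_power F (Suc 0) = F"
| "conv_power F (Suc (Suc k)) =
     (\<lambda>t. LINT s:{0..t}|interval_measure F. conv_power F (Suc k) (t - s))"

definition skorokhod_reflection :: "(real \<Rightarrow> real) \<Rightarrow> real \<Rightarrow> real" where
  "skorokhod_reflection f t = f t + (SUP s\<in>{0..t}. max (- f s) 0)"

text \<open>The next definitions act on single paths: \<open>y\<close> and \<open>c\<close> are realisations of the holding times
  \<open>Y\<close> and of the signs \<open>chi\<close>, both indexed from \<open>1\<close>; the value at \<open>0\<close> is never used. The maximum,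
  the supremum and the left limits exist whenever all holding times are positive with divergent sum,
  hence almost surely in the application; the minimum defining an arrival time exists if moreover
  \<open>c i = 1\<close> for infinitely many \<open>i\<close>. On the exceptional null set the values are unspecified and
  need not be measurable, so probabilities of path events are taken in the completed measure.\<close>

definition renewal_count :: "(nat \<Rightarrow> real) \<Rightarrow> real \<Rightarrow> nat" where
  "renewal_count y t = Max {k. (\<Sum>j=1..k. y j) \<le> t}"

definition renewal_walk :: "(nat \<Rightarrow> real) \<Rightarrow> (nat \<Rightarrow> real) \<Rightarrow> real \<Rightarrow> real" where
  "renewal_walk c y t = (\<Sum>j=1..renewal_count y t. c j)"

definition renewal_queue :: "(nat \<Rightarrow> real) \<Rightarrow> (nat \<Rightarrow> real) \<Rightarrow> real \<Rightarrow> real" where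
  "renewal_queue c y = skorokhod_reflection (renewal_walk c y)"

primrec arrival_time :: "(real \<Rightarrow> real) \<Rightarrow> nat \<Rightarrow> real" where
  "arrival_time q 0 = 0"
| "arrival_time q (Suc n) = (LEAST t. t > arrival_time q n \<and> q t = Lim (at_left t) q + 1)"

definition interarrival_time :: "(real \<Rightarrow> real) \<Rightarrow> nat \<Rightarrow> real" where
  "interarrival_time q n = arrival_time q n - arrival_time q (n - 1)"

end

theory Submission
  imports Defs
begin

text \<open>
  Adding the regulator does not change upward jumps, so almost surely the arrivals of the queue are
  the renewal epochs whose sign is \<open>1\<close>. Hence if \<open>l\<close> and \<open>m\<close> are consecutive indices with sign
  \<open>1\<close>, the corresponding inter-arrival time is \<open>Y (l + 1) + \<dots> + Y m\<close>. Given \<open>l\<close>, the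
  difference \<open>m - l\<close> is geometric and independent of the holding times, and a sum of \<open>j + 1\<close>
  holding times has distribution function \<open>F\<^sup>*\<^sup>(\<^sup>j\<^sup>+\<^sup>1\<^sup>)\<close>; summing over \<open>l\<close> and \<open>j\<close> gives the
  formula. For infinitely many arrivals one needs \<open>p > 0\<close>, which holds because \<open>E\<^sub>\<alpha>(-x) < 1\<close> for
  small \<open>x > 0\<close>: a Mittag-Leffler variable charges every interval \<open>[0, c)\<close>.
\<close>

section \<open>Mittag-Leffler variables\<close>

text \<open>The terms are dominated by a geometric series once \<open>\<alpha> * k + 1 > 2\<close>,
  where Gamma is at least \<open>Gamma 2 = 1\<close>. The unit interval suffices because the series
  is only studied near \<open>0\<close>.\<close>

lemma summable_mittag_leffler:
  fixes \<alpha> x :: real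
  assumes "0 < \<alpha>" "\<bar>x\<bar> < 1"
  shows "summable (\<lambda>k. x ^ k / Gamma (\<alpha> * real k + 1))"
proof (rule summable_comparison_test)
  obtain n :: nat where n: "1 / \<alpha> < real n"
    using reals_Archimedean2 by blast
  show "\<exists>N. \<forall>k\<ge>N. norm (x ^ k / Gamma (\<alpha> * real k + 1)) \<le> \<bar>x\<bar> ^ k"
  proof (intro exI allI impI)
    fix k assume "n \<le> k"
    with n have "1 / \<alpha> < real k" by linarith
    with assms(1) have k: "\<alpha> * real k + 1 > 2" by (simp add: field_simps)
    have "Gamma (2::real) = 1"
      using Gamma_numeral[of "num.Bit0 num.One", where 'a = real] by (simp add: numeral_2_eq_2)
    with Gamma_real_strict_mono[OF _ k] have "Gamma (\<alpha> * real k + 1) \<ge> 1" by simp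
    then show "norm (x ^ k / Gamma (\<alpha> * real k + 1)) \<le> \<bar>x\<bar> ^ k"
      by (simp add: power_abs divide_le_eq mult_right_le_one_le mult_le_cancel_left1)
  qed
  show "summable (\<lambda>k. \<bar>x\<bar> ^ k)"
    using assms(2) by (intro summable_geometric) simp
qed

lemma mittag_leffler_0: "mittag_leffler \<alpha> 0 = 1"
  using powser_zero[of "\<lambda>k. 1 / Gamma (\<alpha> * real k + 1)"]
  by (simp add: mittag_leffler_def)

text \<open>The derivative at \<open>0\<close> is \<open>1 / Gamma (\<alpha> + 1) > 0\<close>, so
  the function is below its value \<open>1\<close> immediately to the left of
  \<open>0\<close>.\<close>

lemma eventually_mittag_leffler_less_1:
  fixes \<alpha> :: real
  assumes "0 < \<alpha>"
  shows "eventually (\<lambda>x. mittag_leffler \<alpha> x < 1) (at_left 0)"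
proof -
  let ?a = "\<lambda>k. 1 / Gamma (\<alpha> * real k + 1)"
  let ?f = "mittag_leffler \<alpha>"
  have "((\<lambda>x. (?f x - 1) / x) \<longlongrightarrow> ?a (Suc 0)) (at 0)"
  \<comment> \<open>The difference quotient is the power series with shifted coefficients, so its
    limit is the constant term \<open>?a (Suc 0)\<close>.\<close>
  proof (rule powser_limit_0_strong[where s = 1 and a = "\<lambda>k. ?a (Suc k)"])
    fix x :: real assume x: "x \<noteq> 0" "norm x < 1"
    then have "(\<lambda>k. ?a k * x ^ k) sums ?f x"
      using summable_mittag_leffler[OF assms, of x]
      unfolding mittag_leffler_def by (simp add: summable_sums)
    then have "(\<lambda>k. ?a (Suc k) * x ^ Suc k) sums (?f x - 1)"
      by (subst sums_Suc_iff) simp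
    from sums_divide[OF this, of x] x show "(\<lambda>k. ?a (Suc k) * x ^ k) sums ((?f x - 1) / x)"
      by (simp add: field_simps)
  qed simp
  moreover have "?a (Suc 0) > 0"
    using assms by (simp add: Gamma_real_pos)
  ultimately have "eventually (\<lambda>x. (?f x - 1) / x > 0) (at 0)"
    by (rule order_tendstoD)
  then have "eventually (\<lambda>x. (?f x - 1) / x > 0) (at_left 0)"
    by (simp add: eventually_at_split)
  moreover have "eventually (\<lambda>x. x < (0::real)) (at_left 0)"
    by (simp add: eventually_at_filter)
  ultimately show ?thesis
    by eventually_elim (auto simp: zero_less_divide_iff)
qed

section \<open>Positivity of \<open>p\<close>\<close>

lemma (in prob_space) mittag_leffler_distributed_prob_pos:
  assumes X: "mittag_leffler_distributed M X \<alpha> lam" and pos: "0 < \<alpha>" "0 < lam" "0 < c"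
  shows "prob {\<omega> \<in> space M. X \<omega> < c} > 0"
proof -
  have [measurable]: "X \<in> borel_measurable M"
    using X by (simp add: mittag_leffler_distributed_def)
  obtain b where b: "b < 0" "\<And>x. b < x \<Longrightarrow> x < 0 \<Longrightarrow> mittag_leffler \<alpha> x < 1"
    using eventually_mittag_leffler_less_1[OF pos(1)] unfolding eventually_at_left_field by auto
  \<comment> \<open>The second bound gives \<open>lam * s powr \<alpha> \<le> - b / 2\<close>, which
    keeps the argument of the tail in the interval where the function is below \<open>1\<close>; the
    first gives \<open>s < c\<close>.\<close>
  define s where "s = min (c / 2) ((- b / (2 * lam)) powr (1 / \<alpha>))"
  have s: "0 < s" "s < c" using b pos by (auto simp: s_def min_def)
  have "s powr \<alpha> \<le> ((- b / (2 * lam)) powr (1 / \<alpha>)) powr \<alpha>"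
    using s pos by (intro powr_mono2) (auto simp: s_def)
  also have "\<dots> = - b / (2 * lam)" using b pos by (simp add: powr_powr)
  finally have "lam * s powr \<alpha> < - b" using b pos by (simp add: field_simps)
  then have "mittag_leffler \<alpha> (- lam * s powr \<alpha>) < 1"
    using b(2)[of "- lam * s powr \<alpha>"] s pos by simp
  then have "prob {\<omega> \<in> space M. X \<omega> > s} < 1"
    using X s by (simp add: mittag_leffler_distributed_def)
  moreover have "prob {\<omega> \<in> space M. \<not> X \<omega> > s} = 1 - prob {\<omega> \<in> space M. X \<omega> > s}"
    by (rule prob_neg) measurable
  ultimately have "0 < prob {\<omega> \<in> space M. \<not> X \<omega> > s}" by simp
  also have "\<dots> \<le> prob {\<omega> \<in> space M. X \<omega> < c}"
    using s by (intro finite_measure_mono) auto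
  finally show ?thesis .
qed

text \<open>The event \<open>X > 0\<close> is the countable union of the events
  \<open>X > 1 / (n + 1)\<close>, so these cannot all be null.\<close>

lemma (in prob_space) ex_prob_greater_pos:
  fixes X :: "'a \<Rightarrow> real"
  assumes [measurable]: "random_variable borel X" and "prob {\<omega> \<in> space M. X \<omega> > 0} > 0"
  shows "\<exists>c>0. prob {\<omega> \<in> space M. X \<omega> > c} > 0"
proof (rule ccontr)
  assume *: "\<not> ?thesis"
  have "AE \<omega> in M. \<not> X \<omega> > inverse (real (Suc n))" for n
    using * prob_eq_0[of "{\<omega> \<in> space M. X \<omega> > inverse (real (Suc n))}"]
    by (auto simp: zero_less_measure_iff simp del: of_nat_Suc)
  then have "AE \<omega> in M. \<forall>n. \<not> X \<omega> > inverse (real (Suc n))"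
    by (simp add: AE_all_countable)
  then have "AE \<omega> in M. \<not> X \<omega> > 0"
    by eventually_elim (use reals_Archimedean in blast)
  then have "prob {\<omega> \<in> space M. X \<omega> > 0} = 0"
    by (subst prob_eq_0) auto
  with assms(2) show False by simp
qed

text \<open>The event contains the rectangle \<open>X1 < c < X2\<close>. The level \<open>c\<close>
  is chosen for \<open>X2\<close> first; every positive level then works for
  \<open>X1\<close>.\<close>

lemma (in prob_space) mittag_leffler_distributed_prob_less_pos:
  assumes X: "mittag_leffler_distributed M X1 \<alpha> lam" "mittag_leffler_distributed M X2 \<beta> \<mu>"
    and pos: "0 < \<alpha>" "0 < lam"
    and indep: "indep_var borel X1 borel X2"
  shows "prob {\<omega> \<in> space M. X1 \<omega> < X2 \<omega>} > 0"
proof -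
  have [measurable]: "random_variable borel X1" "random_variable borel X2"
    using X by (simp_all add: mittag_leffler_distributed_def)
  have "prob {\<omega> \<in> space M. X2 \<omega> > 0} = 1"
    using X(2) mittag_leffler_0 by (simp add: mittag_leffler_distributed_def)
  then obtain c where c: "c > 0" "prob {\<omega> \<in> space M. X2 \<omega> > c} > 0"
    using ex_prob_greater_pos[of X2] by auto
  have "0 < prob {\<omega> \<in> space M. X1 \<omega> < c} * prob {\<omega> \<in> space M. X2 \<omega> > c}"
    using c mittag_leffler_distributed_prob_pos[OF X(1) pos c(1)] by simp
  also have "\<dots> = prob (X1 -` {..<c} \<inter> space M) * prob (X2 -` {c<..} \<inter> space M)"
    by (intro arg_cong2[where f = "(*)"] arg_cong[where f = prob]) auto
  also have "\<dots> = prob ((\<lambda>\<omega>. (X1 \<omega>, X2 \<omega>)) -` ({..<c} \<times> {c<..}) \<inter> space M)"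
    by (rule indep_varD[OF indep, symmetric]) auto
  also have "\<dots> \<le> prob {\<omega> \<in> space M. X1 \<omega> < X2 \<omega>}"
    by (intro finite_measure_mono) auto
  finally show ?thesis .
qed

section \<open>Independent sequences\<close>

text \<open>Borel-Cantelli argument for equal probabilities: missing \<open>A\<close> at the
  \<open>n + 1\<close> indices after \<open>m\<close> has probability
  \<open>(1 - q) ^ (n + 1)\<close>, which tends to \<open>0\<close>.\<close>

lemma (in prob_space) AE_infinitely_often_indep:
  fixes X :: "nat \<Rightarrow> 'a \<Rightarrow> 'b"
  assumes indep: "indep_vars (\<lambda>_. S) X {1..}" and A: "A \<in> sets S"
    and q: "0 < q" "\<And>i. i \<ge> 1 \<Longrightarrow> prob (X i -` A \<inter> space M) = q"
  shows "AE \<omega> in M. \<forall>m. \<exists>i>m. X i \<omega> \<in> A"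
proof -
  have rv [measurable]: "random_variable S (X i)" if "i \<ge> 1" for i
    using indep that unfolding indep_vars_def by auto
  note [measurable] = A
  have "AE \<omega> in M. \<exists>i>m. X i \<omega> \<in> A" for m
  proof -
    \<comment> \<open>The upper end \<open>Suc (m+n)\<close> keeps the block of indices nonempty, as
      the product rule \<open>indep_varsD\<close> requires.\<close>
    let ?C = "\<lambda>n. \<Inter>i\<in>{m<..Suc (m+n)}. X i -` (space S - A) \<inter> space M"
    have q1: "prob (X i -` (space S - A) \<inter> space M) = 1 - q" if "i \<ge> 1" for i
    proof -
      have "X i -` (space S - A) \<inter> space M = space M - (X i -` A \<inter> space M)"
        using measurable_space[OF rv[OF that]] by auto
      then show ?thesis
        using prob_compl[of "X i -` A \<inter> space M"] q(2)[OF that] measurable_sets[OF rv[OF that] A] by simp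
    qed
    have C: "prob (?C n) = (1 - q) ^ Suc n" for n
    proof -
      have "prob (?C n) = (\<Prod>i\<in>{m<..Suc (m+n)}. prob (X i -` (space S - A) \<inter> space M))"
        by (rule indep_varsD[OF indep]) (auto simp: A)
      also have "\<dots> = (\<Prod>i\<in>{m<..Suc (m+n)}. 1 - q)"
        by (intro prod.cong q1) auto
      finally show ?thesis by simp
    qed
    have Cm: "?C n \<in> events" for n
      using rv by (intro sets.finite_INT measurable_sets[OF rv]) auto
    let ?D = "{\<omega> \<in> space M. \<not> (\<exists>i\<in>{m<..}. X i \<omega> \<in> A)}"
    have Dm: "?D \<in> events"
    proof -
      have "?D = space M - (\<Union>i\<in>{m<..}. X i -` A \<inter> space M)" by auto
      also have "\<dots> \<in> events"
        by (intro sets.Diff sets.top sets.countable_UN'' measurable_sets[OF rv] A) auto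
      finally show ?thesis .
    qed
    have le: "prob ?D \<le> (1 - q) ^ Suc n" for n
      unfolding C[symmetric] using measurable_space[OF rv]
      by (intro finite_measure_mono Cm) auto
    have "q \<le> 1" using q(2)[of 1] prob_le_1[of "X 1 -` A \<inter> space M"] by simp
    then have "(\<lambda>n. (1 - q) ^ n) \<longlonglongrightarrow> 0"
      using q(1) by (intro LIMSEQ_power_zero) auto
    then have "(\<lambda>n. (1 - q) ^ Suc n) \<longlonglongrightarrow> 0"
      by (rule LIMSEQ_Suc)
    then have "prob ?D \<le> 0"
      by (rule LIMSEQ_le_const) (use le in auto)
    then have "prob ?D = 0" by (simp add: measure_le_0_iff)
    then have "AE \<omega> in M. \<omega> \<notin> ?D"
      using prob_eq_0[OF Dm] by simp
    then show ?thesis using AE_space by eventually_elim auto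
  qed
  then show ?thesis by (simp add: AE_all_countable)
qed

section \<open>Convolution powers as distribution functions of sums\<close>

lemma cdf_convolution:
  assumes "real_distribution \<mu>" "real_distribution \<nu>"
  shows "cdf (\<mu> \<star> \<nu>) t = (\<integral>x. cdf \<nu> (t - x) \<partial>\<mu>)"
proof -
  interpret \<mu>: real_distribution \<mu> by fact
  interpret \<nu>: real_distribution \<nu> by fact
  have "mono (\<lambda>x. cdf \<nu> x)"
    by (intro monoI \<nu>.cdf_nondecreasing)
  then have [measurable]: "cdf \<nu> \<in> borel_measurable borel"
    by (rule borel_measurable_mono)
  have m: "(\<lambda>x. cdf \<nu> (t - x)) \<in> borel_measurable \<mu>" by measurable
  have "emeasure (\<mu> \<star> \<nu>) {..t} = (\<integral>\<^sup>+x. emeasure \<nu> {a. a + x \<in> {..t}} \<partial>\<mu>)"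
    by (intro convolution_emeasure) (auto intro: \<mu>.finite_measure_axioms \<nu>.finite_measure_axioms)
  also have "\<dots> = (\<integral>\<^sup>+x. ennreal (cdf \<nu> (t - x)) \<partial>\<mu>)"
    by (intro nn_integral_cong)
       (simp add: cdf_def \<nu>.emeasure_eq_measure, intro arg_cong[where f = "measure \<nu>"], auto)
  finally show ?thesis
    using m unfolding cdf_def measure_def
    by (subst integral_eq_nn_integral) auto
qed

text \<open>Induction from one element upwards, as the recursion for \<open>conv_power\<close>
  starts from \<open>F\<close>. Each step convolves with the law of one more variable; to match the
  recursion, this law has to be the Stieltjes measure of \<open>F\<close>, and the integral over the
  line has to reduce to \<open>{0..t}\<close>.\<close>

lemma (in prob_space) cdf_sum_indep:
  fixes Y :: "'i \<Rightarrow> 'a \<Rightarrow> real"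
  assumes J: "finite J" "J \<noteq> {}" and "indep_vars (\<lambda>_. borel) Y J"
    and F: "\<And>i. i \<in> J \<Longrightarrow> cdf (distr M borel (Y i)) = F" and F0: "\<And>x. x < 0 \<Longrightarrow> F x = 0"
  shows "cdf (distr M borel (\<lambda>\<omega>. \<Sum>i\<in>J. Y i \<omega>)) = conv_power F (card J)"
  using assms(1-4)
proof (induction J rule: finite_ne_induct)
  case (singleton i)
  then show ?case by simp
next
  case (insert i J)
  define k where "k = card J - 1"
  have k: "card J = Suc k" using insert.hyps by (simp add: k_def card_gt_0_iff)
  have indJ: "indep_vars (\<lambda>_. borel) Y J"
    using insert.prems(1) by (rule indep_vars_subset) auto
  have IH: "cdf (distr M borel (\<lambda>\<omega>. \<Sum>i\<in>J. Y i \<omega>)) = conv_power F (Suc k)"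
    using insert.IH[OF indJ] insert.prems k by simp
  have rv: "random_variable borel (Y j)" if "j \<in> insert i J" for j
    using insert.prems(1) that unfolding indep_vars_def by auto
  have rvi [measurable]: "random_variable borel (Y i)" using rv by simp
  have rvS [measurable]: "random_variable borel (\<lambda>\<omega>. \<Sum>i\<in>J. Y i \<omega>)"
    using rv by (intro borel_measurable_sum) auto
  let ?\<mu> = "distr M borel (Y i)" and ?\<nu> = "distr M borel (\<lambda>\<omega>. \<Sum>i\<in>J. Y i \<omega>)"
  interpret \<mu>: real_distribution ?\<mu> by (rule real_distribution_distr[OF rvi])
  interpret \<nu>: real_distribution ?\<nu> by (rule real_distribution_distr[OF rvS])
  have Fi: "cdf ?\<mu> = F" using insert.prems by simp
  \<comment> \<open>Both measures have the distribution function \<open>F\<close>, which determines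
    the law.\<close>
  have mu: "interval_measure F = ?\<mu>"
  proof (rule cdf_unique)
    have 1: "\<And>x y. x \<le> y \<Longrightarrow> F x \<le> F y"
      unfolding Fi[symmetric] by (rule \<mu>.cdf_nondecreasing)
    have 2: "\<And>a. continuous (at_right a) F"
      unfolding Fi[symmetric] by (rule \<mu>.cdf_is_right_cont)
    have 3: "(F \<longlongrightarrow> 0) at_bot"
      unfolding Fi[symmetric] by (rule \<mu>.cdf_lim_at_bot)
    have 4: "(F \<longlongrightarrow> 1) at_top"
      unfolding Fi[symmetric] by (rule \<mu>.cdf_lim_at_top_prob)
    show "real_distribution (interval_measure F)"
      by (rule real_distribution_interval_measure[OF 1 2 3 4])
    show "cdf (interval_measure F) = cdf ?\<mu>"
      unfolding Fi by (rule cdf_interval_measure[OF 1 2 3])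
  qed (rule \<mu>.real_distribution_axioms)
  \<comment> \<open>This cuts the integral off at \<open>s = t\<close>, beyond which
    \<open>t - s\<close> is negative.\<close>
  have neg0: "conv_power F (Suc k) x = 0" if "x < 0" for x
    using that F0 by (cases k) (auto simp: set_lebesgue_integral_def)
  \<comment> \<open>This cuts the integral off below \<open>0\<close>: the mass of the open negative
    half-line is the left limit of \<open>F\<close> at \<open>0\<close>.\<close>
  have AE: "AE x in ?\<mu>. 0 \<le> x"
  proof -
    have "(F \<longlongrightarrow> 0) (at_left 0)"
      by (rule tendsto_eventually) (auto simp: eventually_at_left_field F0 intro!: exI[of _ "-1"])
    moreover have "(cdf ?\<mu> \<longlongrightarrow> measure ?\<mu> {..<0}) (at_left 0)"
      by (rule \<mu>.cdf_at_left)
    ultimately have "measure ?\<mu> {..<0} = 0"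
      unfolding Fi using tendsto_unique trivial_limit_at_left_real by blast
    then have "AE x in ?\<mu>. x \<notin> {..<0}"
      by (subst (asm) \<mu>.prob_eq_0) auto
    then show ?thesis by eventually_elim auto
  qed
  have "distr M borel (\<lambda>\<omega>. \<Sum>i\<in>insert i J. Y i \<omega>) = distr M borel (\<lambda>\<omega>. Y i \<omega> + (\<Sum>i\<in>J. Y i \<omega>))"
    using insert.hyps by simp
  also have "\<dots> = (?\<mu> \<star> ?\<nu>)"
    using insert by (intro sum_indep_random_variable indep_vars_sum) auto
  finally have conv: "distr M borel (\<lambda>\<omega>. \<Sum>i\<in>insert i J. Y i \<omega>) = (?\<mu> \<star> ?\<nu>)" .
  show ?case
  proof (rule ext)
    fix t
    have "cdf (distr M borel (\<lambda>\<omega>. \<Sum>i\<in>insert i J. Y i \<omega>)) t = (\<integral>x. conv_power F (Suc k) (t - x) \<partial>?\<mu>)"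
      unfolding conv IH[symmetric]
      by (rule cdf_convolution) (rule \<mu>.real_distribution_axioms \<nu>.real_distribution_axioms)+
    also have "\<dots> = (LINT s:{0..t}|?\<mu>. conv_power F (Suc k) (t - s))"
      unfolding set_lebesgue_integral_def
    proof (rule integral_cong_AE)
      have "mono (\<lambda>x. cdf ?\<nu> x)"
        by (intro monoI \<nu>.cdf_nondecreasing)
      then have [measurable]: "conv_power F (Suc k) \<in> borel_measurable borel"
        unfolding IH by (rule borel_measurable_mono)
      show "(\<lambda>x. conv_power F (Suc k) (t - x)) \<in> borel_measurable ?\<mu>"
        "(\<lambda>x. indicat_real {0..t} x *\<^sub>R conv_power F (Suc k) (t - x)) \<in> borel_measurable ?\<mu>"
        by measurable
      show "AE x in ?\<mu>. conv_power F (Suc k) (t - x) = indicat_real {0..t} x *\<^sub>R conv_power F (Suc k) (t - x)"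
        using AE by eventually_elim (auto simp: neg0 indicator_def)
    qed
    finally show "cdf (distr M borel (\<lambda>\<omega>. \<Sum>i\<in>insert i J. Y i \<omega>)) t = conv_power F (card (insert i J)) t"
      using insert.hyps by (simp add: k mu)
  qed
qed

section \<open>Paths of the queue\<close>

text \<open>A relation instead of a function: a further sign \<open>1\<close> exists only almost
  surely, and each instance reads finitely many signs, which makes it measurable.\<close>

definition next_up :: "(nat \<Rightarrow> real) \<Rightarrow> nat \<Rightarrow> nat \<Rightarrow> bool" where
  "next_up c l m \<longleftrightarrow> l < m \<and> (\<forall>i\<in>{l<..<m}. c i \<noteq> 1) \<and> c m = 1"

text \<open>The start at index \<open>0\<close> matches \<open>arrival_time q 0 = 0\<close>. The
  bound \<open>l < m\<close> makes the quantifier finite, which serves the measurability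
  proof.\<close>

primrec nth_up :: "(nat \<Rightarrow> real) \<Rightarrow> nat \<Rightarrow> nat \<Rightarrow> bool" where
  "nth_up c 0 m \<longleftrightarrow> m = 0"
| "nth_up c (Suc n) m \<longleftrightarrow> (\<exists>l<m. nth_up c n l \<and> next_up c l m)"

lemma next_up_unique: "next_up c l m \<Longrightarrow> next_up c l m' \<Longrightarrow> m = m'"
  unfolding next_up_def by (metis greaterThanLessThan_iff linorder_neqE_nat)

lemma nth_up_unique: "nth_up c n m \<Longrightarrow> nth_up c n m' \<Longrightarrow> m = m'"
  by (induction n arbitrary: m m') (auto dest: next_up_unique)

lemma ex_next_up:
  assumes "\<forall>m. \<exists>i>m. c i = 1"
  shows "\<exists>m. next_up c l m"
proof -
  have ex: "\<exists>i. l < i \<and> c i = 1" using assms by blast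
  define m where "m = (LEAST i. l < i \<and> c i = 1)"
  have "l < m \<and> c m = 1" unfolding m_def by (rule LeastI_ex[OF ex])
  moreover have "c i \<noteq> 1" if "i \<in> {l<..<m}" for i
    using not_less_Least[of i "\<lambda>i. l < i \<and> c i = 1"] that by (auto simp: m_def)
  ultimately show ?thesis unfolding next_up_def by blast
qed

lemma ex_nth_up:
  assumes "\<forall>m. \<exists>i>m. c i = 1"
  shows "\<exists>m. nth_up c n m"
proof (induction n)
  case (Suc n)
  then obtain l where "nth_up c n l" by blast
  moreover obtain m where "next_up c l m" using ex_next_up[OF assms] by blast
  ultimately show ?case by (auto simp: next_up_def)
qed simp

lemma next_up_cong:
  assumes "\<And>i. i \<in> {l<..m} \<Longrightarrow> c i = c' i"
  shows "next_up c l m \<longleftrightarrow> next_up c' l m"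
proof (cases "l < m")
  case True
  then have "c m = c' m" using assms by simp
  moreover have "(\<forall>i\<in>{l<..<m}. c i \<noteq> 1) \<longleftrightarrow> (\<forall>i\<in>{l<..<m}. c' i \<noteq> 1)"
    using assms by (intro ball_cong) auto
  ultimately show ?thesis by (simp add: next_up_def)
qed (simp add: next_up_def)

text \<open>Together with \<open>next_up_cong\<close>, this lets \<open>nth_up c n l\<close> and
  \<open>next_up c l m\<close> be decided by the disjoint blocks \<open>{1..l}\<close> and
  \<open>{l<..m}\<close> of signs, which is the source of their independence.\<close>

lemma nth_up_cong:
  assumes "\<And>i. i \<in> {1..m} \<Longrightarrow> c i = c' i"
  shows "nth_up c n m \<longleftrightarrow> nth_up c' n m"
  using assms
proof (induction n arbitrary: m)
  case (Suc n)
  have "nth_up c n l \<longleftrightarrow> nth_up c' n l" if "l < m" for l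
    using that Suc.prems by (intro Suc.IH) auto
  moreover have "next_up c l m \<longleftrightarrow> next_up c' l m" for l
    using Suc.prems by (intro next_up_cong) auto
  ultimately show ?case by auto
qed simp

section \<open>Deterministic analysis of a single path\<close>

text \<open>These conditions hold almost surely. That the sign \<open>1\<close> recurs forever is
  kept apart and enters through the existence of indices satisfying \<open>nth_up\<close>.\<close>

locale renewal_path =
  fixes c y :: "nat \<Rightarrow> real"
  assumes y_pos: "i \<ge> 1 \<Longrightarrow> y i > 0"
    and sum_y_unbounded: "\<exists>n. t < (\<Sum>j=1..n. y j)"
    and c_cases: "i \<ge> 1 \<Longrightarrow> c i = 1 \<or> c i = -1"
begin

definition S :: "nat \<Rightarrow> real" where "S n = (\<Sum>j=1..n. y j)"

definition walk :: "nat \<Rightarrow> real" where "walk n = (\<Sum>j=1..n. c j)"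

text \<open>Value at the \<open>n\<close>-th renewal epoch of the supremum in the Skorokhod map.\<close>
definition regulator :: "nat \<Rightarrow> real" where
  "regulator n = Max ((\<lambda>j. max (- walk j) 0) ` {..n})"

lemma S_0 [simp]: "S 0 = 0"
  by (simp add: S_def)

lemma S_Suc: "S (Suc n) = S n + y (Suc n)"
  by (simp add: S_def)

lemma S_less_Suc: "S n < S (Suc n)"
  using y_pos[of "Suc n"] by (simp add: S_Suc)

lemma S_strict_mono: "strict_mono S"
  by (simp add: strict_mono_Suc_iff S_less_Suc)

lemma S_mono: "m \<le> n \<Longrightarrow> S m \<le> S n"
  using S_strict_mono by (simp add: strict_mono_less_eq)

lemma ex_step:
  assumes "0 \<le> t"
  obtains n where "S n \<le> t" "t < S (Suc n)"
proof -
  have ex: "\<exists>n. t < S n" using sum_y_unbounded by (simp add: S_def)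
  define m where "m = (LEAST n. t < S n)"
  have m: "t < S m" unfolding m_def using ex by (rule LeastI_ex)
  with assms obtain n where n: "m = Suc n" by (cases m) auto
  have "\<not> t < S n" using not_less_Least[of n "\<lambda>n. t < S n"] n by (simp add: m_def)
  with m n that[of n] show ?thesis by auto
qed

text \<open>Intervals closed on the right serve the left limits: even if \<open>t\<close> is an
  epoch, the path just before \<open>t\<close> is at stage \<open>n\<close>. In that case the index
  from \<open>ex_step\<close> is lowered by one.\<close>

lemma ex_step_left:
  assumes "0 < t"
  obtains n where "S n < t" "t \<le> S (Suc n)"
proof -
  obtain n where n: "S n \<le> t" "t < S (Suc n)" using assms ex_step[of t] by auto
  show ?thesis
  proof (cases "S n < t")
    case True
    with n that show ?thesis by auto
  next
    case False
    with n assms obtain l where "n = Suc l" by (cases n) auto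
    with False n S_less_Suc[of l] that[of l] show ?thesis by auto
  qed
qed

lemma renewal_count_eq:
  assumes "S n \<le> t" "t < S (Suc n)"
  shows "renewal_count y t = n"
proof -
  have "{k. S k \<le> t} = {..n}"
  proof (intro set_eqI)
    fix k
    have "S k \<le> t" if "k \<le> n" using S_mono[OF that] assms by simp
    moreover have "k \<le> n" if "S k \<le> t"
    proof (rule ccontr)
      assume "\<not> k \<le> n"
      then have "S (Suc n) \<le> S k" by (intro S_mono) simp
      with that assms show False by simp
    qed
    ultimately show "k \<in> {k. S k \<le> t} \<longleftrightarrow> k \<in> {..n}" by auto
  qed
  then have "Max {k. S k \<le> t} = Max {..n}" by simp
  also have "\<dots> = n" by (rule Max_eqI) auto
  finally show ?thesis by (simp add: renewal_count_def S_def)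
qed

text \<open>The walk is constant between epochs, and \<open>walk k\<close> is attained at time
  \<open>S k\<close>, so the supremum up to \<open>t\<close> is a maximum over the first
  \<open>n + 1\<close> values of the walk.\<close>

lemma renewal_queue_eq:
  assumes "S n \<le> t" "t < S (Suc n)"
  shows "renewal_queue c y t = walk n + regulator n"
proof -
  have walk: "renewal_walk c y s = walk k" if "S k \<le> s" "s < S (Suc k)" for s k
    using renewal_count_eq[OF that] by (simp add: renewal_walk_def walk_def)
  have "(\<lambda>s. max (- renewal_walk c y s) 0) ` {0..t} = (\<lambda>j. max (- walk j) 0) ` {..n}"
  proof (intro equalityI subsetI)
    fix x assume "x \<in> (\<lambda>s. max (- renewal_walk c y s) 0) ` {0..t}"
    then obtain s where s: "0 \<le> s" "s \<le> t" "x = max (- renewal_walk c y s) 0" by auto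
    from s(1) obtain k where k: "S k \<le> s" "s < S (Suc k)" by (rule ex_step)
    have "k \<le> n"
    proof (rule ccontr)
      assume "\<not> k \<le> n"
      then have "S (Suc n) \<le> S k" by (intro S_mono) simp
      with s k assms show False by simp
    qed
    with walk[OF k] s show "x \<in> (\<lambda>j. max (- walk j) 0) ` {..n}" by auto
  next
    fix x assume "x \<in> (\<lambda>j. max (- walk j) 0) ` {..n}"
    then obtain k where k: "k \<le> n" "x = max (- walk k) 0" by auto
    have "S k \<in> {0..t}" using S_mono[OF k(1)] S_mono[of 0 k] assms by simp
    moreover have "renewal_walk c y (S k) = walk k" using walk S_less_Suc by simp
    ultimately show "x \<in> (\<lambda>s. max (- renewal_walk c y s) 0) ` {0..t}" using k by force
  qed
  then show ?thesis
    using walk[OF assms]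
    by (simp add: renewal_queue_def skorokhod_reflection_def regulator_def cSup_eq_Max)
qed

text \<open>The positive part of the new term is absorbed because \<open>regulator n\<close> is
  already nonnegative.\<close>

lemma regulator_Suc: "regulator (Suc n) = max (regulator n) (- walk (Suc n))"
proof -
  have "regulator (Suc n) = max (max (- walk (Suc n)) 0) (regulator n)"
    by (simp add: regulator_def atMost_Suc)
  moreover have "0 \<le> regulator n"
    unfolding regulator_def by (subst Max_ge_iff) auto
  ultimately show ?thesis by (simp add: max.commute max.left_commute max_def)
qed

lemma regulator_ge: "- walk n \<le> regulator n"
proof -
  have "max (- walk n) 0 \<le> regulator n"
    unfolding regulator_def by (rule Max_ge) auto
  then show ?thesis by simp
qed

text \<open>A down step never raises the queue, because the regulator grows by at most one: it either
  absorbs the step or leaves it visible.\<close>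
lemma walk_regulator_Suc:
  "walk (Suc n) + regulator (Suc n) = walk n + regulator n + 1 \<longleftrightarrow> c (Suc n) = 1"
  using c_cases[of "Suc n"] regulator_ge[of n] by (auto simp: regulator_Suc walk_def max_def)

text \<open>The left limit is the value after the last epoch strictly before \<open>t\<close>. If
  \<open>t\<close> is the next epoch, \<open>walk_regulator_Suc\<close> decides; otherwise the queue
  is constant around \<open>t\<close>.\<close>

lemma renewal_queue_jump_iff:
  assumes "0 < t"
  shows "renewal_queue c y t = Lim (at_left t) (renewal_queue c y) + 1 \<longleftrightarrow> (\<exists>n\<ge>1. t = S n \<and> c n = 1)"
proof -
  obtain n where n: "S n < t" "t \<le> S (Suc n)" using assms by (rule ex_step_left)
  have "eventually (\<lambda>s. renewal_queue c y s = walk n + regulator n) (at_left t)"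
    unfolding eventually_at_left_field using n renewal_queue_eq by (intro exI[of _ "S n"]) auto
  then have Lim: "Lim (at_left t) (renewal_queue c y) = walk n + regulator n"
    by (intro tendsto_Lim tendsto_eventually) auto
  show ?thesis
  proof (cases "t = S (Suc n)")
    case True
    then have "renewal_queue c y t = walk (Suc n) + regulator (Suc n)"
      using S_less_Suc by (intro renewal_queue_eq) auto
    moreover have "(\<exists>m\<ge>1. t = S m \<and> c m = 1) \<longleftrightarrow> c (Suc n) = 1"
      using True strict_mono_eq[OF S_strict_mono] by auto
    ultimately show ?thesis using Lim walk_regulator_Suc[of n] by simp
  next
    case False
    then have "renewal_queue c y t = walk n + regulator n"
      using n by (intro renewal_queue_eq) auto
    moreover have "t \<noteq> S m" for m
    proof
      assume "t = S m"
      with n False have "S n < S m" "S m < S (Suc n)" by auto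
      then show False using strict_mono_less[OF S_strict_mono] by simp
    qed
    ultimately show ?thesis using Lim by simp
  qed
qed

text \<open>The upward jumps after \<open>S l\<close> sit at epochs \<open>S i\<close> with
  \<open>l < i\<close> and \<open>c i = 1\<close>. By \<open>next_up\<close>, the smallest such
  \<open>i\<close> is \<open>m\<close>, and \<open>S\<close> is increasing.\<close>

lemma arrival_time_eq: "nth_up c n m \<Longrightarrow> arrival_time (renewal_queue c y) n = S m"
proof (induction n arbitrary: m)
  case (Suc n)
  then obtain l where l: "nth_up c n l" "next_up c l m" by auto
  note IH = Suc.IH[OF l(1)]
  have S_pos: "0 \<le> S l" using S_mono[of 0 l] by simp
  have lm: "l < m" "c m = 1" and not: "\<And>i. l < i \<Longrightarrow> i < m \<Longrightarrow> c i \<noteq> 1"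
    using l(2) by (auto simp: next_up_def)
  have "(LEAST t. t > S l \<and> renewal_queue c y t = Lim (at_left t) (renewal_queue c y) + 1) = S m"
  proof (rule Least_equality)
    have "S l < S m" using lm S_strict_mono by (simp add: strict_mono_less)
    moreover have "\<exists>n\<ge>1. S m = S n \<and> c n = 1" using lm by (intro exI[of _ m]) auto
    ultimately show "S m > S l \<and> renewal_queue c y (S m) = Lim (at_left (S m)) (renewal_queue c y) + 1"
      using renewal_queue_jump_iff[of "S m"] S_pos by auto
  next
    fix t assume t: "t > S l \<and> renewal_queue c y t = Lim (at_left t) (renewal_queue c y) + 1"
    then obtain i where i: "t = S i" "c i = 1"
      using renewal_queue_jump_iff[of t] S_pos by auto
    with t have "l < i" using S_strict_mono by (simp add: strict_mono_less)
    with not[of i] i have "m \<le> i" by force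
    then show "S m \<le> t" using i S_mono by simp
  qed
  then show ?case by (simp add: IH)
qed simp

lemma interarrival_time_eq:
  assumes "nth_up c n l" "next_up c l m"
  shows "interarrival_time (renewal_queue c y) (Suc n) = (\<Sum>i\<in>{l<..m}. y i)"
proof -
  have lm: "l < m" using assms(2) by (simp add: next_up_def)
  have "nth_up c (Suc n) m" using assms lm by auto
  then have "interarrival_time (renewal_queue c y) (Suc n) = S m - S l"
    unfolding interarrival_time_def
    \<comment> \<open>The recursive equations stay folded so that \<open>arrival_time_eq\<close> can
      rewrite both arrival times.\<close>
    by (simp add: arrival_time_eq assms(1) del: arrival_time.simps nth_up.simps)
  also have "S m = S l + (\<Sum>i\<in>{l<..m}. y i)"
    unfolding S_def using lm
    by (subst sum.union_disjoint[symmetric]) (auto intro!: sum.cong)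
  finally show ?thesis by simp
qed

end

section \<open>Distribution of the inter-arrival times\<close>

text \<open>The index set \<open>I\<close> is left open because the predicate is used both on a
  finite block of signs and on the whole sequence.\<close>

lemma pred_next_up:
  assumes "{l<..m} \<subseteq> I"
  shows "Measurable.pred (PiM I (\<lambda>_. borel)) (\<lambda>c. next_up c l m)"
proof (cases "l < m")
  case True
  have [measurable]: "(\<lambda>c. c i) \<in> borel_measurable (PiM I (\<lambda>_. borel :: real measure))" if "i \<in> {l<..m}" for i
    using assms that by (intro measurable_component_singleton) auto
  show ?thesis
    unfolding next_up_def using True
    by (intro pred_intros_logic pred_intros_finite finite_greaterThanLessThan) measurable
qed (simp add: next_up_def)

lemma pred_nth_up:
  assumes "{1..m} \<subseteq> I"
  shows "Measurable.pred (PiM I (\<lambda>_. borel)) (\<lambda>c. nth_up c n m)"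
  using assms
proof (induction n arbitrary: m)
  case (Suc n)
  have 1: "Measurable.pred (PiM I (\<lambda>_. borel)) (\<lambda>c. nth_up c n l)" if "l \<in> {..<m}" for l
    using that Suc.prems by (intro Suc.IH) auto
  have 2: "Measurable.pred (PiM I (\<lambda>_. borel)) (\<lambda>c. next_up c l m)" for l
    using Suc.prems by (intro pred_next_up) auto
  have "Measurable.pred (PiM I (\<lambda>_. borel)) (\<lambda>c. \<exists>l\<in>{..<m}. nth_up c n l \<and> next_up c l m)"
    using 1 2 by (intro pred_intros_finite pred_intros_logic) auto
  then show ?case by (simp only: nth_up.simps Bex_def lessThan_iff)
qed simp

section \<open>Law of the gap and of the sum of holding times across it\<close>

text \<open>The event prescribes \<open>j\<close> signs different from \<open>1\<close> at the
  indices after \<open>l\<close>, then a sign \<open>1\<close>; independence turns this into a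
  product.\<close>

lemma (in prob_space) prob_next_up:
  fixes chi :: "nat \<Rightarrow> 'a \<Rightarrow> real"
  assumes indep: "indep_vars (\<lambda>_. borel) chi {1..}"
    and p: "\<And>i. i \<ge> 1 \<Longrightarrow> prob {\<omega> \<in> space M. chi i \<omega> = 1} = p"
  shows "prob {\<omega> \<in> space M. next_up (\<lambda>i. chi i \<omega>) l (Suc (l + j))} = (1 - p) ^ j * p"
proof -
  have rv [measurable]: "random_variable borel (chi i)" if "i \<ge> 1" for i
    using indep that unfolding indep_vars_def by auto
  let ?m = "Suc (l + j)"
  let ?A = "\<lambda>i. if i < ?m then - {1} else {1::real}"
  have "{\<omega> \<in> space M. next_up (\<lambda>i. chi i \<omega>) l ?m} = (\<Inter>i\<in>{l<..?m}. chi i -` ?A i \<inter> space M)"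
    by (auto simp: next_up_def split: if_splits)
  also have "prob \<dots> = (\<Prod>i\<in>{l<..?m}. prob (chi i -` ?A i \<inter> space M))"
    by (rule indep_varsD[OF indep]) auto
  also have "\<dots> = (\<Prod>i\<in>{l<..?m}. if i < ?m then 1 - p else p)"
  proof (rule prod.cong[OF refl])
    fix i assume i: "i \<in> {l<..?m}"
    then have [measurable]: "random_variable borel (chi i)" by (intro rv) auto
    have 1: "chi i -` {1} \<inter> space M = {\<omega> \<in> space M. chi i \<omega> = 1}" by auto
    have 2: "chi i -` (- {1}) \<inter> space M = {\<omega> \<in> space M. \<not> chi i \<omega> = 1}" by auto
    have "prob {\<omega> \<in> space M. \<not> chi i \<omega> = 1} = 1 - prob {\<omega> \<in> space M. chi i \<omega> = 1}"
      by (rule prob_neg) measurable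
    with 1 2 p[of i] i show "prob (chi i -` ?A i \<inter> space M) = (if i < ?m then 1 - p else p)"
      by simp
  qed
  also have "{l<..?m} = insert ?m {l<..<?m}" by auto
  also have "(\<Prod>i\<in>insert ?m {l<..<?m}. if i < ?m then 1 - p else p) = (1 - p) ^ j * p"
    by (subst prod.insert) auto
  finally show ?thesis .
qed

text \<open>The two conditions read disjoint blocks of signs. The first factor is left unevaluated,
  as it will be summed over \<open>l\<close>.\<close>

lemma (in prob_space) prob_nth_up_next_up:
  fixes chi :: "nat \<Rightarrow> 'a \<Rightarrow> real"
  assumes indep: "indep_vars (\<lambda>_. borel) chi {1..}"
    and p: "\<And>i. i \<ge> 1 \<Longrightarrow> prob {\<omega> \<in> space M. chi i \<omega> = 1} = p"
  shows "prob {\<omega> \<in> space M. nth_up (\<lambda>i. chi i \<omega>) n l \<and> next_up (\<lambda>i. chi i \<omega>) l (Suc (l + j))} =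
    prob {\<omega> \<in> space M. nth_up (\<lambda>i. chi i \<omega>) n l} * ((1 - p) ^ j * p)"
proof -
  let ?m = "Suc (l + j)"
  let ?P = "PiM {1..l} (\<lambda>_. borel :: real measure)" and ?Q = "PiM {l<..?m} (\<lambda>_. borel :: real measure)"
  let ?X = "\<lambda>\<omega>. restrict (\<lambda>i. chi i \<omega>) {1..l}" and ?Y = "\<lambda>\<omega>. restrict (\<lambda>i. chi i \<omega>) {l<..?m}"
  let ?A = "{c \<in> space ?P. nth_up c n l}" and ?B = "{c \<in> space ?Q. next_up c l ?m}"
  have ind: "indep_var ?P ?X ?Q ?Y"
    by (rule indep_var_restrict[OF indep]) auto
  have A: "?A \<in> sets ?P" and B: "?B \<in> sets ?Q"
    using pred_nth_up[of l "{1..l}" n] pred_next_up[of l ?m "{l<..?m}"] by (simp_all add: pred_def)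
  have eq: "nth_up (?X \<omega>) n l \<longleftrightarrow> nth_up (\<lambda>i. chi i \<omega>) n l"
    "next_up (?Y \<omega>) l ?m \<longleftrightarrow> next_up (\<lambda>i. chi i \<omega>) l ?m" for \<omega>
    by (rule nth_up_cong next_up_cong; simp)+
  have sp: "?X \<omega> \<in> space ?P" "?Y \<omega> \<in> space ?Q" for \<omega>
    by (simp_all add: space_PiM)
  have "{\<omega> \<in> space M. nth_up (\<lambda>i. chi i \<omega>) n l \<and> next_up (\<lambda>i. chi i \<omega>) l ?m} =
    (\<lambda>\<omega>. (?X \<omega>, ?Y \<omega>)) -` (?A \<times> ?B) \<inter> space M"
    using sp eq by auto
  moreover have "{\<omega> \<in> space M. nth_up (\<lambda>i. chi i \<omega>) n l} = ?X -` ?A \<inter> space M"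
    using sp eq by auto
  moreover have "{\<omega> \<in> space M. next_up (\<lambda>i. chi i \<omega>) l ?m} = ?Y -` ?B \<inter> space M"
    using sp eq by auto
  ultimately show ?thesis
    using indep_varD[OF ind A B] prob_next_up[OF indep p, of l j] by (simp only:)
qed

text \<open>The block has \<open>j + 1\<close> members wherever it starts, so the law of the sum
  does not depend on \<open>l\<close>.\<close>

lemma (in prob_space) prob_sum_greater:
  fixes Y :: "nat \<Rightarrow> 'a \<Rightarrow> real"
  assumes indep: "indep_vars (\<lambda>_. borel) Y {1..}"
    and F: "\<And>i. i \<ge> 1 \<Longrightarrow> cdf (distr M borel (Y i)) = F" and F0: "\<And>x. x < 0 \<Longrightarrow> F x = 0"
  shows "prob {\<omega> \<in> space M. (\<Sum>i\<in>{l<..Suc (l + j)}. Y i \<omega>) > t} = 1 - conv_power F (Suc j) t"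
proof -
  let ?J = "{l<..Suc (l + j)}"
  have [measurable]: "random_variable borel (\<lambda>\<omega>. \<Sum>i\<in>?J. Y i \<omega>)"
    using indep unfolding indep_vars_def by (intro borel_measurable_sum) auto
  have "prob {\<omega> \<in> space M. \<not> (\<Sum>i\<in>?J. Y i \<omega>) \<le> t} = 1 - prob {\<omega> \<in> space M. (\<Sum>i\<in>?J. Y i \<omega>) \<le> t}"
    by (rule prob_neg) measurable
  also have "prob {\<omega> \<in> space M. (\<Sum>i\<in>?J. Y i \<omega>) \<le> t} = cdf (distr M borel (\<lambda>\<omega>. \<Sum>i\<in>?J. Y i \<omega>)) t"
    unfolding cdf_def by (subst measure_distr) (auto intro!: arg_cong[where f = prob])
  also have "\<dots> = conv_power F (card ?J) t"
    by (subst cdf_sum_indep[where F = F]) (auto intro: indep_vars_subset[OF indep] F F0)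
  finally show ?thesis by (simp add: not_le)
qed

section \<open>Almost sure regularity of the paths\<close>

text \<open>Positivity comes from \<open>F 0 = 0\<close>, and the two sign probabilities add up to
  \<open>1\<close>. The epochs diverge because some level \<open>s > 0\<close> is exceeded by
  infinitely many holding times.\<close>

lemma (in prob_space) AE_renewal_path:
  fixes chi Y :: "nat \<Rightarrow> 'a \<Rightarrow> real"
  assumes chi: "indep_vars (\<lambda>_. borel) chi {1..}"
    and p: "\<And>i. i \<ge> 1 \<Longrightarrow> prob {\<omega> \<in> space M. chi i \<omega> = 1} = p"
      "\<And>i. i \<ge> 1 \<Longrightarrow> prob {\<omega> \<in> space M. chi i \<omega> = -1} = 1 - p"
    and Y: "indep_vars (\<lambda>_. borel) Y {1..}"
    and F: "\<And>i. i \<ge> 1 \<Longrightarrow> cdf (distr M borel (Y i)) = F" and F0: "F 0 = 0"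
  shows "AE \<omega> in M. renewal_path (\<lambda>i. chi i \<omega>) (\<lambda>i. Y i \<omega>)"
proof -
  have rvc: "random_variable borel (chi i)" and rvY: "random_variable borel (Y i)" if "i \<ge> 1" for i
    using chi Y that unfolding indep_vars_def by auto
  have gt: "prob (Y i -` {s<..} \<inter> space M) = 1 - F s" if i: "i \<ge> 1" for i s
  proof -
    note rvY[OF i, measurable]
    have "prob {\<omega> \<in> space M. \<not> Y i \<omega> \<le> s} = 1 - prob {\<omega> \<in> space M. Y i \<omega> \<le> s}"
      by (rule prob_neg) measurable
    moreover have "prob {\<omega> \<in> space M. Y i \<omega> \<le> s} = F s"
      unfolding F[OF i, symmetric] cdf_def by (subst measure_distr) (auto intro!: arg_cong[where f = prob])
    moreover have "Y i -` {s<..} \<inter> space M = {\<omega> \<in> space M. \<not> Y i \<omega> \<le> s}" by auto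
    ultimately show ?thesis by simp
  qed
  have "AE \<omega> in M. Y i \<omega> > 0" if "i \<ge> 1" for i
  proof -
    have "AE \<omega> in M. \<omega> \<in> Y i -` {0<..} \<inter> space M"
      using gt[OF that, of 0] F0 by (intro AE_prob_1) simp
    then show ?thesis by eventually_elim auto
  qed
  then have AE1: "AE \<omega> in M. \<forall>i\<in>{1..}. Y i \<omega> > 0"
    by (intro AE_ball_countable[THEN iffD2]) auto
  have "AE \<omega> in M. chi i \<omega> = 1 \<or> chi i \<omega> = -1" if i: "i \<ge> 1" for i
  proof -
    note rvc[OF i, measurable]
    have "prob ({\<omega> \<in> space M. chi i \<omega> = 1} \<union> {\<omega> \<in> space M. chi i \<omega> = -1}) = 1"
      using p[OF i] by (subst finite_measure_Union) auto
    from AE_prob_1[OF this] show ?thesis by eventually_elim auto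
  qed
  then have AE2: "AE \<omega> in M. \<forall>i\<in>{1..}. chi i \<omega> = 1 \<or> chi i \<omega> = -1"
    by (intro AE_ball_countable[THEN iffD2]) auto
  \<comment> \<open>Such a level exists because \<open>Y 1\<close> is almost surely positive; each
    holding time then exceeds it with the same probability \<open>1 - F s > 0\<close>.\<close>
  obtain s where s: "s > 0" "F s < 1"
  proof -
    have "prob {\<omega> \<in> space M. Y 1 \<omega> > 0} = 1"
      using gt[of 1 0] F0 by (simp add: vimage_def Int_def conj_commute)
    with ex_prob_greater_pos[OF rvY[of 1]] obtain s where "s > 0" "prob {\<omega> \<in> space M. Y 1 \<omega> > s} > 0" by auto
    with gt[of 1 s] that show ?thesis by (simp add: vimage_def Int_def conj_commute)
  qed
  have AE3: "AE \<omega> in M. \<forall>m. \<exists>i>m. Y i \<omega> \<in> {s<..}"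
    using s gt by (intro AE_infinitely_often_indep[OF Y, where q = "1 - F s"]) auto
  from AE1 AE2 AE3 show ?thesis
  proof eventually_elim
    case (elim \<omega>)
    \<comment> \<open>Each further holding time above \<open>s\<close> raises the partial sums by at
      least \<open>s\<close>, and the ones in between are positive.\<close>
    have "\<exists>n. real k * s \<le> (\<Sum>j=1..n. Y j \<omega>)" for k
    proof (induction k)
      case 0
      show ?case by (intro exI[of _ 0]) simp
    next
      case (Suc k)
      then obtain n where n: "real k * s \<le> (\<Sum>j=1..n. Y j \<omega>)" by blast
      from elim(3) obtain i where i: "n < i" "Y i \<omega> > s" by auto
      have "(\<Sum>j=1..n. Y j \<omega>) + Y i \<omega> = (\<Sum>j\<in>insert i {1..n}. Y j \<omega>)"
        using i by simp
      also have "\<dots> \<le> (\<Sum>j=1..i. Y j \<omega>)"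
        using elim(1) i by (intro sum_mono2) (auto intro: less_imp_le)
      finally show ?case using n i by (intro exI[of _ i]) (simp add: algebra_simps)
    qed
    moreover have "\<exists>k. t < real k * s" for t
      using s reals_Archimedean3 by blast
    ultimately have "\<exists>n. t < (\<Sum>j=1..n. Y j \<omega>)" for t
      by (meson less_le_trans)
    with elim show ?case by (unfold_locales) auto
  qed
qed

section \<open>Summation over the arrival index and the gap\<close>

text \<open>Up to a null set, the event splits according to the index \<open>l\<close> of the
  \<open>n\<close>-th arrival and the gap \<open>j + 1\<close> to the next one. Each piece combines
  a condition on the signs with one on the holding times, so its probability factors.\<close>

lemma (in prob_space) interarrival_time_sums:
  fixes chi Y :: "nat \<Rightarrow> 'a \<Rightarrow> real"
  assumes chi: "indep_vars (\<lambda>_. borel) chi {1..}"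
    and p: "\<And>i. i \<ge> 1 \<Longrightarrow> prob {\<omega> \<in> space M. chi i \<omega> = 1} = p"
      "\<And>i. i \<ge> 1 \<Longrightarrow> prob {\<omega> \<in> space M. chi i \<omega> = -1} = 1 - p" "p > 0"
    and Y: "indep_vars (\<lambda>_. borel) Y {1..}"
    and F: "\<And>i. i \<ge> 1 \<Longrightarrow> cdf (distr M borel (Y i)) = F" and F0: "\<And>x. x \<le> 0 \<Longrightarrow> F x = 0"
    and chi_Y: "indep_var (PiM {1..} (\<lambda>_. borel)) (\<lambda>\<omega>. \<lambda>i\<in>{1..}. chi i \<omega>)
      (PiM {1..} (\<lambda>_. borel)) (\<lambda>\<omega>. \<lambda>i\<in>{1..}. Y i \<omega>)"
  shows "(\<lambda>j. (1 - conv_power F (Suc j) t) * ((1 - p) ^ j * p)) sums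
    measure (completion M)
      {\<omega> \<in> space M. interarrival_time (renewal_queue (\<lambda>i. chi i \<omega>) (\<lambda>i. Y i \<omega>)) (Suc n) > t}"
proof -
  let ?P = "PiM {1..} (\<lambda>_. borel :: real measure)"
  let ?c = "\<lambda>\<omega> i. chi i \<omega>" and ?y = "\<lambda>\<omega> i. Y i \<omega>"
  let ?X = "\<lambda>\<omega>. \<lambda>i\<in>{1..}. chi i \<omega>" and ?Z = "\<lambda>\<omega>. \<lambda>i\<in>{1..}. Y i \<omega>"
  have X [measurable]: "?X \<in> measurable M ?P" and Z [measurable]: "?Z \<in> measurable M ?P"
    using chi_Y by (auto dest: indep_var_rv1 indep_var_rv2)
  define g where "g j = (1 - conv_power F (Suc j) t) * ((1 - p) ^ j * p)" for j
  define a where "a l = {\<omega> \<in> space M. nth_up (?c \<omega>) n l}" for l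
  define E where "E j l = {\<omega> \<in> space M. (nth_up (?c \<omega>) n l \<and> next_up (?c \<omega>) l (Suc (l + j))) \<and>
    (\<Sum>i\<in>{l<..Suc (l + j)}. Y i \<omega>) > t}" for j l
  define D where "D j = (\<Union>l. E j l)" for j
  have nth: "nth_up (?X \<omega>) n l \<longleftrightarrow> nth_up (?c \<omega>) n l" for \<omega> l
    by (rule nth_up_cong) simp
  have nxt: "next_up (?X \<omega>) l m \<longleftrightarrow> next_up (?c \<omega>) l m" for \<omega> l m
    by (rule next_up_cong) simp
  have a_sets: "a l \<in> events" for l
    unfolding a_def nth[symmetric]
    using measurable_compose[OF X pred_nth_up[of l "{1..}" n]] by (simp add: pred_def)
  have E: "E j l \<in> events" "prob (E j l) = prob (a l) * g j" for j l
  proof -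
    let ?m = "Suc (l + j)"
    let ?A = "{c \<in> space ?P. nth_up c n l \<and> next_up c l ?m}"
    let ?B = "{y \<in> space ?P. (\<Sum>i\<in>{l<..?m}. y i) > t}"
    have sub: "{l<..?m} \<subseteq> {1..}" by auto
    have A: "?A \<in> sets ?P"
      using pred_nth_up[of l "{1..}" n] pred_next_up[of l ?m "{1..}", OF sub]
      by (auto simp: pred_def intro!: sets.sets_Collect)
    have B: "?B \<in> sets ?P"
    proof -
      have [measurable]: "(\<lambda>y. \<Sum>i\<in>{l<..?m}. y i) \<in> borel_measurable ?P"
        by (intro borel_measurable_sum measurable_component_singleton) auto
      show ?thesis by measurable
    qed
    have sp: "?X \<omega> \<in> space ?P" "?Z \<omega> \<in> space ?P" for \<omega>
      by (simp_all add: space_PiM)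
    have XA: "{\<omega> \<in> space M. nth_up (?c \<omega>) n l \<and> next_up (?c \<omega>) l ?m} = ?X -` ?A \<inter> space M"
      using sp nth nxt by auto
    have sumZ: "(\<Sum>i\<in>{l<..?m}. ?Z \<omega> i) = (\<Sum>i\<in>{l<..?m}. Y i \<omega>)" for \<omega>
      by (rule sum.cong) auto
    have ZB: "{\<omega> \<in> space M. (\<Sum>i\<in>{l<..?m}. Y i \<omega>) > t} = ?Z -` ?B \<inter> space M"
      unfolding sumZ[symmetric] using sp by auto
    have E_eq: "E j l = (\<lambda>\<omega>. (?X \<omega>, ?Z \<omega>)) -` (?A \<times> ?B) \<inter> space M"
      using XA ZB unfolding E_def by blast
    have "E j l = (?X -` ?A \<inter> space M) \<inter> (?Z -` ?B \<inter> space M)"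
      unfolding E_eq by blast
    then show "E j l \<in> events"
      using measurable_sets[OF X A] measurable_sets[OF Z B] by simp
    have "prob (E j l) = prob (?X -` ?A \<inter> space M) * prob (?Z -` ?B \<inter> space M)"
      unfolding E_eq by (rule indep_varD[OF chi_Y A B])
    also have "prob (?Z -` ?B \<inter> space M) = 1 - conv_power F (Suc j) t"
      unfolding ZB[symmetric] using F0 by (intro prob_sum_greater[OF Y F]) auto
    also have "prob (?X -` ?A \<inter> space M) = prob (a l) * ((1 - p) ^ j * p)"
      unfolding XA[symmetric] a_def by (rule prob_nth_up_next_up[OF chi p(1)])
    finally show "prob (E j l) = prob (a l) * g j" by (simp add: g_def)
  qed
  have "AE \<omega> in M. \<forall>m. \<exists>i>m. chi i \<omega> \<in> {1}"
    using p by (intro AE_infinitely_often_indep[OF chi, where q = p]) (auto simp: vimage_def Int_def conj_commute)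
  then have AE_up: "AE \<omega> in M. \<forall>m. \<exists>i>m. chi i \<omega> = 1" by simp
  have "(\<lambda>l. prob (a l)) sums prob (\<Union>l. a l)"
    using a_sets by (intro finite_measure_UNION) (auto simp: disjoint_family_on_def a_def dest: nth_up_unique)
  moreover have "AE \<omega> in M. \<omega> \<in> (\<Union>l. a l)"
    using AE_up AE_space by eventually_elim (auto simp: a_def intro: ex_nth_up)
  then have "prob (\<Union>l. a l) = 1"
    using a_sets by (subst prob_eq_1) auto
  ultimately have "(\<lambda>l. prob (a l)) sums 1" by simp
  \<comment> \<open>Summing over \<open>l\<close> removes the law of the \<open>n\<close>-th arrival
    index: the weights \<open>prob (a l)\<close> add up to \<open>1\<close>.\<close>
  from sums_mult2[OF this] have "(\<lambda>l. prob (E j l)) sums g j" for j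
    by (simp add: E)
  moreover have "(\<lambda>l. prob (E j l)) sums prob (D j)" for j
    unfolding D_def using E(1)
    by (intro finite_measure_UNION) (auto simp: disjoint_family_on_def E_def dest: nth_up_unique)
  ultimately have D: "prob (D j) = g j" for j
    by (rule sums_unique2[symmetric])
  have D_sets: "D j \<in> events" for j
    unfolding D_def using E(1) by auto
  have "disjoint_family D"
    unfolding disjoint_family_on_def
  proof (intro ballI impI)
    fix i j :: nat assume "i \<noteq> j"
    show "D i \<inter> D j = {}"
    proof (rule ccontr)
      assume "D i \<inter> D j \<noteq> {}"
      then obtain \<omega> l l' where *: "nth_up (?c \<omega>) n l" "next_up (?c \<omega>) l (Suc (l + i))"
        "nth_up (?c \<omega>) n l'" "next_up (?c \<omega>) l' (Suc (l' + j))"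
        by (auto simp: D_def E_def)
      then have "l = l'" by (blast dest: nth_up_unique)
      with * next_up_unique have "Suc (l + i) = Suc (l + j)" by blast
      with \<open>i \<noteq> j\<close> show False by simp
    qed
  qed
  then have "(\<lambda>j. prob (D j)) sums prob (\<Union>j. D j)"
    using D_sets by (intro finite_measure_UNION) auto
  then have sums: "g sums prob (\<Union>j. D j)" by (simp add: D)
  let ?T = "{\<omega> \<in> space M. interarrival_time (renewal_queue (?c \<omega>) (?y \<omega>)) (Suc n) > t}"
  have "AE \<omega> in M. renewal_path (?c \<omega>) (?y \<omega>)"
    using F0 by (intro AE_renewal_path[OF chi p(1,2) Y F]) auto
  \<comment> \<open>On a regular path with infinitely many signs \<open>1\<close>, the indices
    \<open>l\<close> and \<open>m\<close> exist and are unique, so both sides say that the same sum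
    exceeds \<open>t\<close>.\<close>
  with AE_up AE_space have AE: "AE \<omega> in M. \<omega> \<in> (\<Union>j. D j) \<longleftrightarrow> \<omega> \<in> ?T"
  proof eventually_elim
    case (elim \<omega>)
    obtain l where l: "nth_up (?c \<omega>) n l" using ex_nth_up[OF elim(1)] by blast
    obtain m where m: "next_up (?c \<omega>) l m" using ex_next_up[OF elim(1)] by blast
    then obtain j where j: "m = Suc (l + j)"
      unfolding next_up_def using less_imp_Suc_add by blast
    have "\<omega> \<in> (\<Union>j. D j) \<longleftrightarrow> (\<Sum>i\<in>{l<..m}. Y i \<omega>) > t"
    proof
      assume "\<omega> \<in> (\<Union>j. D j)"
      then obtain l' j' where *: "nth_up (?c \<omega>) n l'" "next_up (?c \<omega>) l' (Suc (l' + j'))"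
        "(\<Sum>i\<in>{l'<..Suc (l' + j')}. Y i \<omega>) > t" by (auto simp: D_def E_def)
      then have "l' = l" using l by (blast dest: nth_up_unique)
      with * m have "Suc (l' + j') = m" by (blast dest: next_up_unique)
      with * \<open>l' = l\<close> show "(\<Sum>i\<in>{l<..m}. Y i \<omega>) > t" by simp
    next
      assume "(\<Sum>i\<in>{l<..m}. Y i \<omega>) > t"
      with l m elim(2) have "\<omega> \<in> E j l" unfolding j by (simp add: E_def)
      then show "\<omega> \<in> (\<Union>j. D j)" by (auto simp: D_def)
    qed
    also have "\<dots> \<longleftrightarrow> \<omega> \<in> ?T"
      using renewal_path.interarrival_time_eq[OF elim(3) l m] elim(2) by simp
    finally show ?case .
  qed
  have U: "(\<Union>j. D j) \<in> events" using D_sets by auto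
  have AE': "AE \<omega> in completion M. \<omega> \<in> (\<Union>j. D j) \<longleftrightarrow> \<omega> \<in> ?T"
    using AE by (rule AE_completion)
  have "(\<Union>j. D j) \<in> sets (completion M)" using U by simp
  \<comment> \<open>Completeness turns almost sure agreement with an event into measurability of
    \<open>?T\<close>.\<close>
  moreover from AE' this have "?T \<in> sets (completion M)"
    by (rule completion.in_sets_AE) auto
  ultimately have "measure (completion M) (\<Union>j. D j) = measure (completion M) ?T"
    using AE' by (intro measure_eq_AE)
  with sums U show ?thesis by (simp add: g_def[abs_def])
qed

text \<open>The pair \<open>X1\<close>, \<open>X2\<close> lives on a space of its own, as it only
  serves to define \<open>p\<close>. The form with \<open>sums\<close> asserts convergence along
  with the value.\<close>

theorem theorem2p5:
  fixes \<alpha> \<beta> lam \<mu> p t :: real and k :: nat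
    and N :: "'b measure" and X1 X2 :: "'b \<Rightarrow> real"
    and M :: "'a measure" and chi Y :: "nat \<Rightarrow> 'a \<Rightarrow> real"
  assumes "0 < \<alpha>" "\<alpha> \<le> 1" "0 < \<beta>" "\<beta> \<le> 1" "0 < lam" "0 < \<mu>"
    and "prob_space N"
    and "mittag_leffler_distributed N X1 \<alpha> lam" "mittag_leffler_distributed N X2 \<beta> \<mu>"
    and "prob_space.indep_var N borel X1 borel X2"
    and "p = measure N {\<omega> \<in> space N. X1 \<omega> < X2 \<omega>}"
    and "prob_space M"
    and "prob_space.indep_vars M (\<lambda>_. borel) chi {1..}"
    and "\<And>i. i \<ge> 1 \<Longrightarrow> measure M {\<omega> \<in> space M. chi i \<omega> = 1} = p"
    and "\<And>i. i \<ge> 1 \<Longrightarrow> measure M {\<omega> \<in> space M. chi i \<omega> = -1} = 1 - p"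
    and "prob_space.indep_vars M (\<lambda>_. borel) Y {1..}"
    and "\<And>i. i \<ge> 1 \<Longrightarrow> cdf (distr M borel (Y i)) = min_mittag_leffler_cdf \<alpha> lam \<beta> \<mu>"
    and "prob_space.indep_var M
           (PiM {1..} (\<lambda>_. borel)) (\<lambda>\<omega>. \<lambda>i\<in>{1..}. chi i \<omega>)
           (PiM {1..} (\<lambda>_. borel)) (\<lambda>\<omega>. \<lambda>i\<in>{1..}. Y i \<omega>)"
    and "k \<ge> 1" "t > 0"
  shows "(\<lambda>j. (1 - conv_power (min_mittag_leffler_cdf \<alpha> lam \<beta> \<mu>) (j + 1) t) * (1 - p) ^ j * p) sums
           measure (completion M)
             {\<omega> \<in> space M. interarrival_time (renewal_queue (\<lambda>i. chi i \<omega>) (\<lambda>i. Y i \<omega>)) k > t}"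
proof -
  let ?F = "min_mittag_leffler_cdf \<alpha> lam \<beta> \<mu>"
  have "p > 0"
    using prob_space.mittag_leffler_distributed_prob_less_pos[OF assms(7-9,1,5,10)] assms(11) by simp
  \<comment> \<open>At \<open>0\<close> both Mittag-Leffler factors equal \<open>1\<close>, so
    \<open>?F\<close> has no atom there; this makes the holding times almost surely
    positive.\<close>
  moreover have "?F x = 0" if "x \<le> 0" for x
    using that by (cases "x = 0") (simp_all add: min_mittag_leffler_cdf_def mittag_leffler_0)
  \<comment> \<open>The \<open>k\<close>-th inter-arrival time starts at arrival number
    \<open>n\<close>.\<close>
  moreover obtain n where "k = Suc n" using assms(19) by (cases k) auto
  ultimately show ?thesis
    using prob_space.interarrival_time_sums[OF assms(12-15) _ assms(16,17) _ assms(18), of t n]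
    by (simp add: mult.assoc)
qed

end
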